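(* For $\alpha,\beta>0$, the topology $\tau_H$ on $\mathcal{M}(\alpha,\beta,(A_0,A_1))$ is a Hausdorff topology.
   Context: Hilbert spaces are complex; $L(K_0,K_1)$ denotes bounded linear operators, $L(K)=L(K,K)$. For $T\in L(K)$, $\operatorname{Re}T=\frac12(T+T^* )$, and $\operatorname{Re}T\ge c$ means $\operatorname{Re}\langle T\phi,\phi\rangle\ge c\|\phi\|^2$ for all $\phi$. Standing setting: $H_0,H_1,H_2$ are Hilbert spaces; $A_0:\operatorname{dom}(A_0)\subseteq H_0\to H_1$ and $A_1:\operatorname{dom}(A_1)\subseteq H_1\to H_2$ are densely defined closed linear operators; $(A_0,A_1)$ is closed and exact, i.e. $\operatorname{ran}(A_0)$, $\operatorname{ran}(A_1)$ are closed and $\operatorname{ran}(A_0)=\ker(A_1)$. Then $H_1=\operatorname{ran}(A_0)\oplus\operatorname{ran}(A_1^* )$ orthogonally. Let $\iota_0:\operatorname{ran}(A_0)\hookrightarrow H_1$ and $\iota_1:\operatorname{ran}(A_1^* )\hookrightarrow H_1$ be the canonical embeddings. For $a\in L(H_1)$ put $a_{jk}=\iota_j^*a\iota_k$ ($j,k\in\{0,1\}$); $a_{00}^{-1}$ means $(a_{00})^{-1}$ and $(a^{-1})_{11}^{-1}$ means $((a^{-1})_{11})^{-1}$. $\mathcal{M}(\alpha,\beta,(A_0,A_1))$ is the set of continuously invertible $a\in L(H_1)$ with $\operatorname{Re}a_{00}\ge\alpha$, $\operatorname{Re}a_{00}^{-1}\ge1/\beta$, $\operatorname{Re}(a^{-1})_{11}\ge1/\beta$,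 $\operatorname{Re}(a^{-1})_{11}^{-1}\ge\alpha$. $\tau_H$ is the initial topology on $\mathcal{M}(\alpha,\beta,(A_0,A_1))$ making the following four maps continuous, where $L_{\mathrm w}$ denotes bounded operators with the weak operator topology: $a\mapsto a_{00}^{-1}\in L_{\mathrm w}(\operatorname{ran}(A_0))$, $a\mapsto a_{10}a_{00}^{-1}\in L_{\mathrm w}(\operatorname{ran}(A_0),\operatorname{ran}(A_1^* ))$, $a\mapsto a_{00}^{-1}a_{01}\in L_{\mathrm w}(\operatorname{ran}(A_1^* ),\operatorname{ran}(A_0))$, $a\mapsto a_{11}-a_{10}a_{00}^{-1}a_{01}\in L_{\mathrm w}(\operatorname{ran}(A_1^* ))$. *)

theory Defs
  imports "HOL-Analysis.Analysis"
begin

section \<open>Complex Hilbert spaces\<close>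

text \<open>
  A complex inner product space is a real inner product space (which supplies norm and topology)
  with a compatible complex scalar multiplication and a sesquilinear form, linear in the first
  argument, whose real part is the real inner product. Positive definiteness of \<open>cinner\<close>
  and \<open>norm x = sqrt (Re (cinner x x))\<close> are then inherited from the class
  \<^class>\<open>real_inner\<close>.
\<close>

class complex_inner = real_inner +
  fixes scaleC :: "complex \<Rightarrow> 'a \<Rightarrow> 'a"
    and cinner :: "'a \<Rightarrow> 'a \<Rightarrow> complex"
  assumes scaleC_add_right: "scaleC c (x + y) = scaleC c x + scaleC c y"
    and scaleC_add_left: "scaleC (c + d) x = scaleC c x + scaleC d x"
    and scaleC_scaleC: "scaleC c (scaleC d x) = scaleC (c * d) x"
    and scaleR_eq_scaleC: "scaleR r x = scaleC (complex_of_real r) x"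
    and cinner_commute: "cinner x y = cnj (cinner y x)"
    and cinner_add_left: "cinner (x + y) z = cinner x z + cinner y z"
    and cinner_scaleC_left: "cinner (scaleC c x) y = c * cinner x y"
    and inner_eq_Re_cinner: "inner x y = Re (cinner x y)"

class chilbert_space = complex_inner + complete_space

instantiation complex :: chilbert_space
begin

definition scaleC_complex :: "complex \<Rightarrow> complex \<Rightarrow> complex"
  where "scaleC_complex c x = c * x"

definition cinner_complex :: "complex \<Rightarrow> complex \<Rightarrow> complex"
  where "cinner_complex x y = x * cnj y"

instance
  by standard
    (simp_all add: scaleC_complex_def cinner_complex_def inner_complex_def algebra_simps
      scaleR_conv_of_real)

end


section \<open>Operators between subspaces\<close>

text \<open>
  An operator \<open>T\<close> with domain \<open>D\<close> is a function of which only the values on \<open>D\<close> matter.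
  Closed subspaces of a Hilbert space are treated as sets, and a bounded operator between such
  subspaces is normalised to be \<^term>\<open>undefined\<close> outside its domain, so that equality of operators
  is equality of functions.
\<close>

definition csubspace :: "'a::complex_inner set \<Rightarrow> bool"
  where "csubspace S \<longleftrightarrow>
    0 \<in> S \<and> (\<forall>x\<in>S. \<forall>y\<in>S. x + y \<in> S) \<and> (\<forall>c. \<forall>x\<in>S. scaleC c x \<in> S)"

definition clinear_on :: "'a::complex_inner set \<Rightarrow> ('a \<Rightarrow> 'b::complex_inner) \<Rightarrow> bool"
  where "clinear_on D T \<longleftrightarrow> csubspace D \<and>
    (\<forall>x\<in>D. \<forall>y\<in>D. T (x + y) = T x + T y) \<and> (\<forall>c. \<forall>x\<in>D. T (scaleC c x) = scaleC c (T x))"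

definition bounded_ops ::
    "'a::complex_inner set \<Rightarrow> 'b::complex_inner set \<Rightarrow> ('a \<Rightarrow> 'b) set"
  where "bounded_ops U V = {T. T \<in> extensional U \<and> T ` U \<subseteq> V \<and> clinear_on U T \<and>
    (\<exists>K. \<forall>x\<in>U. norm (T x) \<le> K * norm x)}"

text \<open>
  Adjoint of an operator \<open>T\<close> with domain \<open>D\<close> dense in \<open>U\<close> and values in \<open>V\<close>. It covers both the
  unbounded operators (\<open>U = V = UNIV\<close>) and the canonical embeddings (\<open>D = U\<close>, \<open>V = UNIV\<close>).
\<close>

definition adj_dom ::
    "'a::complex_inner set \<Rightarrow> 'b::complex_inner set \<Rightarrow> 'a set \<Rightarrow> ('a \<Rightarrow> 'b) \<Rightarrow> 'b set"
  where "adj_dom U V D T = {y \<in> V. \<exists>z\<in>U. \<forall>x\<in>D. cinner (T x) y = cinner x z}"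

definition adj ::
    "'a::complex_inner set \<Rightarrow> 'b::complex_inner set \<Rightarrow> 'a set \<Rightarrow> ('a \<Rightarrow> 'b) \<Rightarrow> 'b \<Rightarrow> 'a"
  where "adj U V D T =
    (\<lambda>y \<in> adj_dom U V D T. THE z. z \<in> U \<and> (\<forall>x\<in>D. cinner (T x) y = cinner x z))"

definition op_inv :: "'a set \<Rightarrow> 'b set \<Rightarrow> ('a \<Rightarrow> 'b) \<Rightarrow> 'b \<Rightarrow> 'a"
  where "op_inv U V T = (\<lambda>y\<in>V. inv_into U T y)"

definition Re_ge :: "'a::complex_inner set \<Rightarrow> ('a \<Rightarrow> 'a) \<Rightarrow> real \<Rightarrow> bool"
  where "Re_ge U T c \<longleftrightarrow> (\<forall>\<phi>\<in>U. Re (cinner (T \<phi>) \<phi>) \<ge> c * (norm \<phi>)\<^sup>2)"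


section \<open>Initial topologies\<close>

definition initial_topology :: "'x set \<Rightarrow> (('x \<Rightarrow> 'y) \<times> 'y topology) set \<Rightarrow> 'x topology"
  where "initial_topology X F =
    topology_generated_by (insert X {f -` W \<inter> X | f Y W. (f, Y) \<in> F \<and> openin Y W})"

lemma topspace_initial_topology [simp]: "topspace (initial_topology X F) = X"
  by (auto simp: initial_topology_def)

definition weak_op_topology ::
    "'a::complex_inner set \<Rightarrow> 'b::complex_inner set \<Rightarrow> ('a \<Rightarrow> 'b) topology"
  where "weak_op_topology U V =
    initial_topology (bounded_ops U V) {(\<lambda>T. cinner (T u) v, euclidean) | u v. u \<in> U \<and> v \<in> V}"


section \<open>Closed and exact pairs\<close>

definition densely_defined_closed ::
    "'a::chilbert_space set \<Rightarrow> ('a \<Rightarrow> 'b::chilbert_space) \<Rightarrow> bool"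
  where "densely_defined_closed D A \<longleftrightarrow>
    clinear_on D A \<and> closure D = UNIV \<and> closed {(x, A x) | x. x \<in> D}"

definition closed_exact ::
    "'a::chilbert_space set \<Rightarrow> ('a \<Rightarrow> 'b::chilbert_space) \<Rightarrow>
     'b set \<Rightarrow> ('b \<Rightarrow> 'c::chilbert_space) \<Rightarrow> bool"
  where "closed_exact D0 A0 D1 A1 \<longleftrightarrow>
    closed (A0 ` D0) \<and> closed (A1 ` D1) \<and> A0 ` D0 = {x \<in> D1. A1 x = 0}"

definition ran_adj :: "'b::chilbert_space set \<Rightarrow> ('b \<Rightarrow> 'c::chilbert_space) \<Rightarrow> 'b set"
  where "ran_adj D A = adj UNIV UNIV D A ` adj_dom UNIV UNIV D A"


section \<open>Nonlocal coefficients and nonlocal H-convergence\<close>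

definition emb :: "'b set \<Rightarrow> 'b \<Rightarrow> 'b"
  where "emb U = (\<lambda>x\<in>U. x)"

text \<open>\<open>block V U a\<close> is \<open>\<iota>\<^sub>V\<^sup>* a \<iota>\<^sub>U\<close>, an operator from \<open>U\<close> to \<open>V\<close>.\<close>

definition block :: "'b::chilbert_space set \<Rightarrow> 'b set \<Rightarrow> ('b \<Rightarrow> 'b) \<Rightarrow> 'b \<Rightarrow> 'b"
  where "block V U a = compose U (adj V UNIV V (emb V)) (compose U a (emb U))"

text \<open>
  The inverses of \<open>a\<^sub>0\<^sub>0\<close> and \<open>(a\<^sup>-\<^sup>1)\<^sub>1\<^sub>1\<close> below need no separate invertibility hypothesis: the strict
  positivity conditions on these operators imply it, by the Lax--Milgram lemma.
\<close>

definition coeffs ::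
    "real \<Rightarrow> real \<Rightarrow> 'a::chilbert_space set \<Rightarrow> ('a \<Rightarrow> 'b::chilbert_space) \<Rightarrow>
     'b set \<Rightarrow> ('b \<Rightarrow> 'c::chilbert_space) \<Rightarrow> ('b \<Rightarrow> 'b) set"
  where "coeffs \<alpha> \<beta> D0 A0 D1 A1 =
    (let R0 = A0 ` D0; R1 = ran_adj D1 A1 in
      {a \<in> bounded_ops UNIV UNIV. bij a \<and> op_inv UNIV UNIV a \<in> bounded_ops UNIV UNIV \<and>
        Re_ge R0 (block R0 R0 a) \<alpha> \<and>
        Re_ge R0 (op_inv R0 R0 (block R0 R0 a)) (1 / \<beta>) \<and>
        Re_ge R1 (block R1 R1 (op_inv UNIV UNIV a)) (1 / \<beta>) \<and>
        Re_ge R1 (op_inv R1 R1 (block R1 R1 (op_inv UNIV UNIV a))) \<alpha>})"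

definition tau_H ::
    "real \<Rightarrow> real \<Rightarrow> 'a::chilbert_space set \<Rightarrow> ('a \<Rightarrow> 'b::chilbert_space) \<Rightarrow>
     'b set \<Rightarrow> ('b \<Rightarrow> 'c::chilbert_space) \<Rightarrow> ('b \<Rightarrow> 'b) topology"
  where "tau_H \<alpha> \<beta> D0 A0 D1 A1 =
    (let R0 = A0 ` D0; R1 = ran_adj D1 A1;
         inv00 = (\<lambda>a. op_inv R0 R0 (block R0 R0 a)) in
      initial_topology (coeffs \<alpha> \<beta> D0 A0 D1 A1)
       {(\<lambda>a. inv00 a, weak_op_topology R0 R0),
        (\<lambda>a. compose R0 (block R1 R0 a) (inv00 a), weak_op_topology R0 R1),
        (\<lambda>a. compose R1 (inv00 a) (block R0 R1 a), weak_op_topology R1 R0),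
        (\<lambda>a. (\<lambda>x\<in>R1. block R1 R1 a x - block R1 R0 a (inv00 a (block R0 R1 a x))),
          weak_op_topology R1 R1)})"

lemma topspace_tau_H: "topspace (tau_H \<alpha> \<beta> D0 A0 D1 A1) = coeffs \<alpha> \<beta> D0 A0 D1 A1"
  by (simp add: tau_H_def Let_def)

end

theory Submission
  imports Defs
begin

text \<open>
  An initial topology is Hausdorff as soon as its defining maps take values in Hausdorff spaces
  and together separate points. The weak operator topology is of this kind, because an operator
  into a subspace \<open>V\<close> is determined by its matrix elements against vectors of \<open>V\<close>. So the claim
  is that \<open>a\<close> is determined by \<open>a\<^sub>0\<^sub>0\<^sup>-\<^sup>1\<close>, \<open>a\<^sub>1\<^sub>0 a\<^sub>0\<^sub>0\<^sup>-\<^sup>1\<close>, \<open>a\<^sub>0\<^sub>0\<^sup>-\<^sup>1 a\<^sub>0\<^sub>1\<close> and the Schur complement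
  \<open>a\<^sub>1\<^sub>1 - a\<^sub>1\<^sub>0 a\<^sub>0\<^sub>0\<^sup>-\<^sup>1 a\<^sub>0\<^sub>1\<close>. Algebraically this is immediate: inverting the first gives \<open>a\<^sub>0\<^sub>0\<close>, and then
  the others give \<open>a\<^sub>1\<^sub>0\<close>, \<open>a\<^sub>0\<^sub>1\<close>, \<open>a\<^sub>1\<^sub>1\<close> in turn (\<open>Schur_data_determine_blocks\<close>).

  The analysis lies in two places. First, the four maps must really take bounded operators as
  values. This holds because \<open>a\<^sub>0\<^sub>0\<close> is coercive, hence boundedly invertible by the Lax--Milgram
  lemma (\<open>op_inv_in_bounded_ops\<close>). Secondly, the four blocks determine \<open>a\<close>
  (\<open>blocks_determine_operator\<close>) only because \<open>ran(A\<^sub>0)\<close> and \<open>ran(A\<^sub>1\<^sup>*)\<close> span the whole space, that is,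
  \<open>ran(A\<^sub>1\<^sup>*)\<close> is the full orthogonal complement of \<open>ran(A\<^sub>0) = ker(A\<^sub>1)\<close> and not merely a
  dense part of it. That is the closed range theorem (\<open>ran_adj_eq_orthogonal_comp_kernel\<close>): if
  \<open>y\<close> is orthogonal to \<open>ker(A\<^sub>1)\<close>, then \<open>A\<^sub>1 x \<mapsto> \<langle>x, y\<rangle>\<close> is a well-defined functional on \<open>ran(A\<^sub>1)\<close>,
  bounded by the open mapping theorem, and a Riesz vector \<open>w\<close> of it satisfies \<open>A\<^sub>1\<^sup>* w = y\<close>.

  All orthogonality arguments are carried out for the real inner product. They transfer to the
  complex one because a complex subspace is invariant under multiplication by \<open>\<i>\<close>
  (\<open>cinner_eq_if_inner_eq\<close>).
\<close>

section \<open>Riesz representation and the Lax--Milgram lemma\<close>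

text \<open>
  The Riesz vector is the minimiser of the quadratic functional \<open>\<parallel>x\<parallel>\<^sup>2 - 2 f x\<close>. The parallelogram
  law makes every minimising sequence Cauchy. Stated on a subspace, the lemma serves both for
  functionals on a closed range and, with \<open>f x = \<langle>x, y\<rangle>\<close>, for orthogonal projections.
\<close>

lemma riesz_representation_on_complete_subspace:
  fixes W :: "'a::real_inner set" and f :: "'a \<Rightarrow> real"
  assumes W: "subspace W" "complete W"
    and add: "\<And>x y. x \<in> W \<Longrightarrow> y \<in> W \<Longrightarrow> f (x + y) = f x + f y"
    and scale: "\<And>r x. x \<in> W \<Longrightarrow> f (r *\<^sub>R x) = r * f x"
    and bound: "\<And>x. x \<in> W \<Longrightarrow> \<bar>f x\<bar> \<le> K * norm x"
  obtains w where "w \<in> W" "\<And>x. x \<in> W \<Longrightarrow> f x = inner x w"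
proof -
  define J where "J x = (norm x)\<^sup>2 - 2 * f x" for x
  define m where "m = Inf (J ` W)"
  have "- (K\<^sup>2) \<le> J x" if "x \<in> W" for x
  proof -
    have "0 \<le> (norm x - K)\<^sup>2" by simp
    then have "2 * (K * norm x) \<le> (norm x)\<^sup>2 + K\<^sup>2"
      by (simp add: power2_diff mult.commute mult.left_commute)
    then show ?thesis
      using bound[OF that] by (simp add: J_def)
  qed
  then have bdd: "bdd_below (J ` W)" by (auto intro!: bdd_belowI[where m = "- (K\<^sup>2)"])
  have ne: "W \<noteq> {}" using W(1) subspace_0 by blast
  have mle: "m \<le> J x" if "x \<in> W" for x
    unfolding m_def using bdd that by (simp add: cInf_lower)
  have "\<exists>x\<in>W. J x < m + inverse (real (Suc n))" for n
  proof -
    have "m < m + inverse (real (Suc n))" by simp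
    then show ?thesis unfolding m_def using cInf_lessD[of "J ` W"] ne by blast
  qed
  then obtain s where s: "\<And>n. s n \<in> W" "\<And>n. J (s n) < m + inverse (real (Suc n))"
    by metis
  have par: "(norm (x - y))\<^sup>2 = 2 * J x + 2 * J y - 4 * J ((1/2) *\<^sub>R (x + y))"
    if "x \<in> W" "y \<in> W" for x y
  proof -
    have "f ((1/2) *\<^sub>R (x + y)) = (f x + f y) / 2"
      using that add scale W(1) by (simp add: subspace_add)
    then show ?thesis
      unfolding J_def power2_norm_eq_inner
      by (simp add: inner_add inner_diff inner_commute algebra_simps)
  qed
  have "Cauchy s"
  proof (rule metric_CauchyI)
    fix e :: real assume "e > 0"
    then have "e\<^sup>2 / 4 > 0" by simp
    then obtain N where N: "N > 0" "inverse (real N) < e\<^sup>2 / 4"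
      using ex_inverse_of_nat_less by blast
    have "dist (s i) (s j) < e" if "i \<ge> N" "j \<ge> N" for i j
    proof -
      have *: "inverse (real (Suc k)) < e\<^sup>2 / 4" if "k \<ge> N" for k
        using N that by (smt (verit) inverse_le_imp_le le_imp_inverse_le of_nat_0_less_iff of_nat_Suc of_nat_mono)
      have "(1/2) *\<^sub>R (s i + s j) \<in> W"
        using s(1) W(1) by (simp add: subspace_add subspace_scale)
      then have "(norm (s i - s j))\<^sup>2 < e\<^sup>2"
        using par[OF s(1) s(1), of i j] mle[of "(1/2) *\<^sub>R (s i + s j)"]
          s(2)[of i] s(2)[of j] *[OF that(1)] *[OF that(2)]
        by linarith
      then show ?thesis
        using \<open>e > 0\<close> by (simp add: dist_norm power2_less_imp_less)
    qed
    then show "\<exists>M. \<forall>i\<ge>M. \<forall>j\<ge>M. dist (s i) (s j) < e" by blast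
  qed
  then obtain w where w: "w \<in> W" "s \<longlonglongrightarrow> w"
    using W(2) s(1) unfolding complete_def by blast
  have "f x = inner x w" if x: "x \<in> W" for x
  proof -
    define d where "d = inner x w - f x"
    \<comment> \<open>First-order optimality, tested on the minimising sequence itself so that continuity of \<open>f\<close> is avoided.\<close>
    have quad: "0 \<le> 2 * t * d + t\<^sup>2 * (norm x)\<^sup>2" for t
    proof -
      have le: "0 \<le> 2 * t * (inner x (s n) - f x) + t\<^sup>2 * (norm x)\<^sup>2 + inverse (real (Suc n))" for n
      proof -
        have "s n + t *\<^sub>R x \<in> W" using s(1) x W(1) by (simp add: subspace_add subspace_scale)
        moreover have "J (s n + t *\<^sub>R x)
            = J (s n) + 2 * t * (inner x (s n) - f x) + t\<^sup>2 * (norm x)\<^sup>2"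
          unfolding J_def power2_norm_eq_inner
          using s(1)[of n] x W(1)
          by (simp add: add scale subspace_scale inner_add inner_commute algebra_simps power2_eq_square)
        ultimately show ?thesis using mle s(2)[of n] by fastforce
      qed
      have "(\<lambda>n. 2 * t * (inner x (s n) - f x) + t\<^sup>2 * (norm x)\<^sup>2 + inverse (real (Suc n)))
          \<longlonglongrightarrow> 2 * t * d + t\<^sup>2 * (norm x)\<^sup>2 + 0"
        unfolding d_def by (intro tendsto_intros w LIMSEQ_inverse_real_of_nat)
      then show ?thesis using le by (metis (no_types, lifting) LIMSEQ_le_const add.right_neutral)
    qed
    have "d = 0"
    proof (rule ccontr)
      assume "d \<noteq> 0"
      \<comment> \<open>The quadratic \<open>2 t d + t\<^sup>2 q\<close> is negative at its vertex \<open>t = - d / q\<close>; the summand 1 keeps \<open>q\<close> positive.\<close>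
      define q where "q = (norm x)\<^sup>2 + 1"
      have q: "q > 0" "(norm x)\<^sup>2 \<le> q" unfolding q_def by (simp_all add: add_nonneg_pos)
      have "0 \<le> 2 * (- d / q) * d + (- d / q)\<^sup>2 * q"
        using quad[of "- d / q"] q(2) by (smt (verit) mult_left_mono zero_le_power2)
      also have "\<dots> = - (d\<^sup>2 / q)" using q by (simp add: power2_eq_square field_simps)
      finally show False using \<open>d \<noteq> 0\<close> q by (simp add: field_simps)
    qed
    then show ?thesis by (simp add: d_def)
  qed
  with w(1) that show thesis by blast
qed

text \<open>
  Solving \<open>T x = y\<close> amounts to finding a fixed point of \<open>x \<mapsto> x - \<rho> (T x - y)\<close>, and coercivity makes
  this map a contraction when \<open>\<rho> > 0\<close> is small. Injectivity and the bound on the inverse follow from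
  coercivity and the Cauchy--Schwarz inequality.
\<close>

lemma lax_milgram_on_complete_subspace:
  fixes V :: "'a::real_inner set"
  assumes V: "subspace V" "complete V"
    and maps: "\<And>x. x \<in> V \<Longrightarrow> T x \<in> V"
    and add: "\<And>x y. x \<in> V \<Longrightarrow> y \<in> V \<Longrightarrow> T (x + y) = T x + T y"
    and scale: "\<And>r x. x \<in> V \<Longrightarrow> T (r *\<^sub>R x) = r *\<^sub>R T x"
    and bound: "\<And>x. x \<in> V \<Longrightarrow> norm (T x) \<le> K * norm x"
    and "\<alpha> > 0"
    and coercive: "\<And>x. x \<in> V \<Longrightarrow> \<alpha> * (norm x)\<^sup>2 \<le> inner (T x) x"
  shows "bij_betw T V V" and "x \<in> V \<Longrightarrow> norm x \<le> norm (T x) / \<alpha>"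
proof -
  have diff: "T (x - y) = T x - T y" if "x \<in> V" "y \<in> V" for x y
    using add[of x "(-1) *\<^sub>R y"] scale[of y "-1"] that V(1) by (simp add: subspace_neg)
  have below: "norm x \<le> norm (T x) / \<alpha>" if "x \<in> V" for x
  proof (cases "x = 0")
    case False
    have "\<alpha> * norm x * norm x \<le> norm (T x) * norm x"
      using coercive[OF that] norm_cauchy_schwarz[of "T x" x] by (simp add: power2_eq_square mult.assoc)
    then show ?thesis using False \<open>\<alpha> > 0\<close> by (simp add: field_simps)
  qed (use \<open>\<alpha> > 0\<close> in simp)
  then show "x \<in> V \<Longrightarrow> norm x \<le> norm (T x) / \<alpha>" .
  have "inj_on T V"
  proof (rule inj_onI)
    fix x y assume "x \<in> V" "y \<in> V" "T x = T y"
    then show "x = y" using below[of "x - y"] V(1) by (simp add: diff subspace_diff)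
  qed
  moreover have "T ` V = V"
  proof
    show "V \<subseteq> T ` V"
    proof
      fix y assume y: "y \<in> V"
      \<comment> \<open>\<open>L\<close> bounds the norm of \<open>T\<close> and dominates \<open>\<alpha>\<close>; the choice of \<open>\<rho>\<close> minimises \<open>1 - 2 \<rho> \<alpha> + \<rho>\<^sup>2 L\<^sup>2\<close>,\<close>
      \<comment> \<open>whose minimum \<open>1 - (\<alpha> / L)\<^sup>2\<close> is the square of the contraction constant \<open>c\<close>.\<close>
      define L where "L = \<bar>K\<bar> + \<alpha>"
      have L: "L > 0" "\<alpha> \<le> L" using \<open>\<alpha> > 0\<close> by (simp_all add: L_def)
      define \<rho> where "\<rho> = \<alpha> / L\<^sup>2"
      define c where "c = sqrt (1 - (\<alpha> / L)\<^sup>2)"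
      have ratio: "0 < \<alpha> / L" "\<alpha> / L \<le> 1" using L \<open>\<alpha> > 0\<close> by simp_all
      then have c: "0 \<le> c" "c < 1" "c\<^sup>2 = 1 - (\<alpha> / L)\<^sup>2"
        unfolding c_def by (auto simp: power_le_one)
      define g where "g x = x - \<rho> *\<^sub>R (T x - y)" for x
      have contract: "norm (z - \<rho> *\<^sub>R T z) \<le> c * norm z" if z: "z \<in> V" for z
      proof -
        have "norm (T z) \<le> L * norm z"
          using bound[OF z] \<open>\<alpha> > 0\<close> unfolding L_def
          by (smt (verit) abs_ge_self mult_right_mono norm_ge_zero)
        then have up: "(norm (T z))\<^sup>2 \<le> L\<^sup>2 * (norm z)\<^sup>2"
          by (metis norm_ge_zero power_mono power_mult_distrib)
        have "(norm (z - \<rho> *\<^sub>R T z))\<^sup>2 = (norm z)\<^sup>2 - 2 * \<rho> * inner (T z) z + \<rho>\<^sup>2 * (norm (T z))\<^sup>2"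
          unfolding power2_norm_eq_inner
          by (simp add: inner_diff inner_commute algebra_simps power2_eq_square)
        also have "\<dots> \<le> (norm z)\<^sup>2 - 2 * \<rho> * (\<alpha> * (norm z)\<^sup>2) + \<rho>\<^sup>2 * (L\<^sup>2 * (norm z)\<^sup>2)"
        proof -
          have "\<rho> \<ge> 0" using \<open>\<alpha> > 0\<close> by (simp add: \<rho>_def)
          then show ?thesis
            using mult_left_mono[OF coercive[OF z], of "2 * \<rho>"] mult_left_mono[OF up, of "\<rho>\<^sup>2"]
            by simp
        qed
        also have "\<dots> = (c * norm z)\<^sup>2"
        proof -
          have "\<rho> * \<alpha> = (\<alpha> / L)\<^sup>2" by (simp add: \<rho>_def power2_eq_square)
          moreover have "\<rho>\<^sup>2 * L\<^sup>2 = (\<alpha> / L)\<^sup>2"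
            using L by (simp add: \<rho>_def power2_eq_square)
          ultimately show ?thesis
            unfolding power_mult_distrib c(3) by algebra
        qed
        finally show ?thesis by (rule power2_le_imp_le) (simp add: c(1))
      qed
      have "\<exists>!x\<in>V. g x = x"
      proof (rule Banach_fix[OF V(2) _ c(1,2)])
        show "V \<noteq> {}" using y by blast
        show "g ` V \<subseteq> V"
          using y maps V(1) by (auto simp: g_def intro!: subspace_diff subspace_scale)
        fix x z assume xz: "x \<in> V" "z \<in> V"
        have "g x - g z = (x - z) - \<rho> *\<^sub>R T (x - z)"
          using xz by (simp add: g_def diff algebra_simps)
        then show "dist (g x) (g z) \<le> c * dist x z"
          using contract[of "x - z"] xz V(1) by (simp add: dist_norm subspace_diff)
      qed
      then obtain x where "x \<in> V" "g x = x" by blast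
      moreover have "\<rho> \<noteq> 0" using L \<open>\<alpha> > 0\<close> by (simp add: \<rho>_def)
      ultimately show "y \<in> T ` V" by (auto simp: g_def)
    qed
  qed (use maps in blast)
  ultimately show "bij_betw T V V" by (simp add: bij_betw_def)
qed

section \<open>Open mapping theorem for operators with closed range\<close>

text \<open>
  The range is complete and is exhausted by the closures of the images of balls, so by Baire's
  theorem one of these closures contains a nonempty relatively open set. Each of them is convex and
  symmetric, so it then contains a neighbourhood of the origin in the range.
\<close>

lemma closed_range_operator_almost_open:
  fixes A :: "'a::real_normed_vector \<Rightarrow> 'b::banach"
  assumes D: "subspace D"
    and add: "\<And>x y. x \<in> D \<Longrightarrow> y \<in> D \<Longrightarrow> A (x + y) = A x + A y"
    and scale: "\<And>r x. x \<in> D \<Longrightarrow> A (r *\<^sub>R x) = r *\<^sub>R A x"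
    and range: "closed (A ` D)"
  obtains n r where "n \<ge> 0" "r > 0" "A ` D \<inter> cball 0 r \<subseteq> closure (A ` {x \<in> D. norm x \<le> n})"
proof -
  define F where "F n = closure (A ` {x \<in> D. norm x \<le> real n})" for n :: nat
  let ?X = "top_of_set (A ` D)"
  have 0: "A 0 = 0" "0 \<in> D" using scale[of 0 0] D by (simp_all add: subspace_0)
  have F_sub: "F n \<subseteq> A ` D" for n
    unfolding F_def by (rule closure_minimal) (use range in auto)
  have "completely_metrizable_space ?X"
    using range by (simp add: completely_metrizable_space_closedin completely_metrizable_space_euclidean)
  moreover have "(\<Union>n. F n) = A ` D"
  proof
    show "A ` D \<subseteq> (\<Union>n. F n)"
      using real_arch_simple closure_subset unfolding F_def by fast
  qed (use F_sub in blast)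
  moreover have "?X interior_of (A ` D) \<noteq> {}"
    using interior_of_topspace[of ?X] 0 by auto
  moreover have "closedin ?X (F n)" for n
    using F_sub by (simp add: F_def closed_subset)
  ultimately obtain n where "?X interior_of (F n) \<noteq> {}"
    using Baire_category_alt[of ?X "range F"] by (metis countableI_type countable_image rangeE)
  then obtain z where "z \<in> ?X interior_of (F n)" by blast
  then obtain U where "openin ?X U" "z \<in> U" "U \<subseteq> F n"
    unfolding interior_of_def by blast
  then obtain r where r: "r > 0" "z \<in> A ` D" "ball z r \<inter> A ` D \<subseteq> F n"
    unfolding openin_contains_ball by blast
  have sym: "- v \<in> F n" if v: "v \<in> F n" for v
    unfolding F_def closure_approachable
  proof (intro allI impI)
    fix e :: real assume "e > 0"
    then obtain x where x: "x \<in> D" "norm x \<le> real n" "dist (A x) v < e"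
      using v unfolding F_def closure_approachable by blast
    have "- A x \<in> A ` {x \<in> D. norm x \<le> real n}"
      using scale[of x "-1"] x D by (intro image_eqI[of _ _ "- x"]) (auto simp: subspace_neg)
    then show "\<exists>y\<in>A ` {x \<in> D. norm x \<le> real n}. dist y (- v) < e"
      using x(3) by (intro bexI[of _ "- A x"]) (auto simp: dist_minus)
  qed
  have "convex (A ` {x \<in> D. norm x \<le> real n})"
  proof (rule convexI, clarify)
    fix x y and u v :: real
    assume *: "0 \<le> u" "0 \<le> v" "u + v = 1" "x \<in> D" "norm x \<le> real n" "y \<in> D" "norm y \<le> real n"
    have "norm (u *\<^sub>R x + v *\<^sub>R y) \<le> u * real n + v * real n"
      using * by (intro norm_triangle_le add_mono) (auto simp: mult_left_mono)
    also have "\<dots> = real n" using * by (metis distrib_right mult_1)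
    finally show "u *\<^sub>R A x + v *\<^sub>R A y \<in> A ` {x \<in> D. norm x \<le> real n}"
      using * D by (intro image_eqI[of _ _ "u *\<^sub>R x + v *\<^sub>R y"])
        (auto simp: add scale subspace_add subspace_scale)
  qed
  then have conv: "convex (F n)" unfolding F_def by (rule convex_closure)
  have subR: "subspace (A ` D)"
  proof (rule subspaceI)
    show "0 \<in> A ` D" using 0 by force
    show "u + v \<in> A ` D" if "u \<in> A ` D" "v \<in> A ` D" for u v
      using that D by clarify (metis add image_eqI subspace_add)
    show "c *\<^sub>R u \<in> A ` D" if "u \<in> A ` D" for u c
      using that D by clarify (metis scale image_eqI subspace_scale)
  qed
  have "A ` D \<inter> cball 0 (r/2) \<subseteq> F n"
  proof
    fix v assume v: "v \<in> A ` D \<inter> cball 0 (r/2)"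
    have "norm v < r" using v r(1) by simp
    then have p: "z + v \<in> F n" and q: "z - v \<in> F n"
      using r v subR by (auto intro!: subsetD[OF r(3)] simp: dist_norm subspace_add subspace_diff)
    have "(1/2) *\<^sub>R (z + v) + (1/2) *\<^sub>R (- (z - v)) \<in> F n"
      using conv p sym[OF q] by (rule convexD) auto
    moreover have "(1/2) *\<^sub>R (z + v) + (1/2) *\<^sub>R (- (z - v)) = v"
      by (simp add: algebra_simps flip: scaleR_add_left)
    ultimately show "v \<in> F n" by simp
  qed
  with r(1) show thesis using that[of "real n" "r/2"] by (simp add: F_def)
qed

text \<open>
  Almost openness gives, for each \<open>z\<close> in the range, some \<open>f z\<close> of norm at most \<open>c \<parallel>z\<parallel>\<close> whose image
  misses \<open>z\<close> by at most \<open>\<parallel>z\<parallel> / 2\<close>. Correcting the remaining error again and again produces a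
  geometrically convergent series, and closedness of the graph identifies the image of its sum as \<open>z\<close>.
\<close>

lemma closed_range_operator_bounded_preimages:
  fixes A :: "'a::banach \<Rightarrow> 'b::banach"
  assumes D: "subspace D"
    and add: "\<And>x y. x \<in> D \<Longrightarrow> y \<in> D \<Longrightarrow> A (x + y) = A x + A y"
    and scale: "\<And>r x. x \<in> D \<Longrightarrow> A (r *\<^sub>R x) = r *\<^sub>R A x"
    and graph: "closed {(x, A x) | x. x \<in> D}"
    and range: "closed (A ` D)"
  obtains C where "\<And>z. z \<in> A ` D \<Longrightarrow> \<exists>x\<in>D. A x = z \<and> norm x \<le> C * norm z"
proof -
  obtain n r where nr: "n \<ge> 0" "r > 0"
    and open': "A ` D \<inter> cball 0 r \<subseteq> closure (A ` {x \<in> D. norm x \<le> n})"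
    using closed_range_operator_almost_open[OF D add scale range] by blast
  define c where "c = n / r"
  have c0: "c \<ge> 0" using nr by (simp add: c_def)
  have diff: "A (x - y) = A x - A y" if "x \<in> D" "y \<in> D" for x y
    using add[of x "(-1) *\<^sub>R y"] scale[of y "-1"] that D by (simp add: subspace_neg)
  have 0: "A 0 = 0" "0 \<in> D" using scale[of 0 0] D by (simp_all add: subspace_0)
  have "\<exists>x\<in>D. norm x \<le> c * norm z \<and> norm (z - A x) \<le> norm z / 2" if z: "z \<in> A ` D" for z
  proof (cases "z = 0")
    case True then show ?thesis using 0 by force
  next
    case False
    define s where "s = r / norm z"
    have s: "s > 0" using False nr by (simp add: s_def)
    obtain x0 where x0: "x0 \<in> D" "z = A x0" using z by blast
    have "s *\<^sub>R z = A (s *\<^sub>R x0)" "s *\<^sub>R x0 \<in> D" using x0 D by (simp_all add: scale subspace_scale)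
    moreover have "norm (s *\<^sub>R z) = r" using False nr by (simp add: s_def)
    ultimately have "s *\<^sub>R z \<in> closure (A ` {x \<in> D. norm x \<le> n})"
      using open' by (auto intro!: subsetD[OF open'])
    moreover have "r / 2 > 0" using nr by simp
    ultimately obtain x where x: "x \<in> D" "norm x \<le> n" "dist (A x) (s *\<^sub>R z) < r / 2"
      unfolding closure_approachable by blast
    have "norm (inverse s *\<^sub>R x) \<le> c * norm z"
      using x(2) False nr by (simp add: s_def c_def field_simps)
    moreover have "norm (z - A (inverse s *\<^sub>R x)) \<le> norm z / 2"
    proof -
      have "z - A (inverse s *\<^sub>R x) = inverse s *\<^sub>R (s *\<^sub>R z - A x)"
        using x(1) s by (simp add: scale algebra_simps)
      then have "norm (z - A (inverse s *\<^sub>R x)) = inverse s * dist (A x) (s *\<^sub>R z)"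
        using s by (simp add: dist_norm norm_minus_commute)
      also have "\<dots> \<le> inverse s * (r / 2)" using x(3) s by simp
      also have "\<dots> = norm z / 2" using nr by (simp add: s_def)
      finally show ?thesis .
    qed
    ultimately show ?thesis using x(1) D by (intro bexI[of _ "inverse s *\<^sub>R x"]) (auto simp: subspace_scale)
  qed
  then obtain f where f: "\<And>z. z \<in> A ` D \<Longrightarrow> f z \<in> D"
      "\<And>z. z \<in> A ` D \<Longrightarrow> norm (f z) \<le> c * norm z"
      "\<And>z. z \<in> A ` D \<Longrightarrow> norm (z - A (f z)) \<le> norm z / 2"
    by metis
  have "\<exists>x\<in>D. A x = z \<and> norm x \<le> 2 * c * norm z" if z: "z \<in> A ` D" for z
  proof -
    \<comment> \<open>\<open>R k\<close> is the error left after \<open>k\<close> corrections.\<close>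
    define R where "R k = ((\<lambda>v. v - A (f v)) ^^ k) z" for k
    have R0: "R 0 = z" and RS: "R (Suc k) = R k - A (f (R k))" for k
      by (simp_all add: R_def)
    have RD: "R k \<in> A ` D" for k
    proof (induction k)
      case (Suc k)
      then obtain x where "x \<in> D" "R k = A x" by blast
      then show ?case using f(1)[OF Suc] D by (simp add: RS flip: diff) (simp add: subspace_diff)
    qed (use z R0 in simp)
    have Rn: "norm (R k) \<le> norm z * (1/2) ^ k" for k
    proof (induction k)
      case (Suc k)
      then show ?case using f(3)[OF RD[of k]] by (simp add: RS)
    qed (simp add: R0)
    define g where "g k = f (R k)" for k
    have gn: "norm (g k) \<le> c * norm z * (1/2) ^ k" for k
      using f(2)[OF RD[of k]] mult_left_mono[OF Rn[of k] c0] by (simp add: g_def mult.assoc)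
    have geo: "(\<lambda>k. c * norm z * (1/2) ^ k) sums (c * norm z * 2)"
      using sums_mult[OF geometric_sums[of "1/2 :: real"], of "c * norm z"] by simp
    have sumg: "summable (\<lambda>k. norm (g k))"
      by (rule summable_comparison_test'[OF sums_summable[OF geo]]) (use gn in simp)
    have part: "(\<Sum>k<m. g k) \<in> D \<and> A (\<Sum>k<m. g k) = z - R m" for m
    proof (induction m)
      case (Suc m)
      have "g m \<in> D" using f(1) RD by (simp add: g_def)
      with Suc show ?case using D by (simp add: add subspace_add RS g_def)
    qed (simp add: 0 R0)
    have "R \<longlonglongrightarrow> 0"
    proof (rule Lim_null_comparison)
      show "(\<lambda>k. norm z * (1/2) ^ k) \<longlonglongrightarrow> 0"
        using tendsto_mult_right_zero[OF LIMSEQ_power_zero[of "1/2 :: real"]] by simp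
    qed (use Rn in simp)
    then have "(\<lambda>m. z - R m) \<longlonglongrightarrow> z - 0" by (intro tendsto_intros)
    then have "(\<lambda>m. A (\<Sum>k<m. g k)) \<longlonglongrightarrow> z" using part by simp
    then have "(\<lambda>m. (\<Sum>k<m. g k, A (\<Sum>k<m. g k))) \<longlonglongrightarrow> (suminf g, z)"
      using summable_LIMSEQ[OF summable_norm_cancel[OF sumg]] by (intro tendsto_Pair)
    then have "(suminf g, z) \<in> {(x, A x) | x. x \<in> D}"
      by (rule closed_sequentially[OF graph, rotated]) (use part in blast)
    then have "suminf g \<in> D" "A (suminf g) = z" by auto
    moreover have "norm (suminf g) \<le> 2 * c * norm z"
      using summable_norm[OF sumg] suminf_le[OF gn sumg sums_summable[OF geo]] sums_unique[OF geo]
      by simp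
    ultimately show ?thesis by blast
  qed
  then show thesis using that by blast
qed

section \<open>Complex inner product spaces and bounded operators\<close>

instance chilbert_space \<subseteq> banach ..

lemma bounded_opsI:
  assumes "T \<in> extensional U" "\<And>x. x \<in> U \<Longrightarrow> T x \<in> V" "clinear_on U T"
    and "\<And>x. x \<in> U \<Longrightarrow> norm (T x) \<le> K * norm x"
  shows "T \<in> bounded_ops U V"
  using assms unfolding bounded_ops_def by blast

lemma bounded_ops_normE:
  assumes "T \<in> bounded_ops U V"
  obtains K where "\<And>x. x \<in> U \<Longrightarrow> norm (T x) \<le> K * norm x"
  using assms unfolding bounded_ops_def by blast

lemma csubspace_imp_subspace: "csubspace S \<Longrightarrow> subspace S"
  by (simp add: csubspace_def subspace_def scaleR_eq_scaleC)

lemma csubspace_diff: "csubspace S \<Longrightarrow> x \<in> S \<Longrightarrow> y \<in> S \<Longrightarrow> x - y \<in> S"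
  by (simp add: csubspace_imp_subspace subspace_diff)

lemma cinner_scaleC_right: "cinner x (scaleC c y) = cnj c * cinner x y"
  by (metis cinner_commute cinner_scaleC_left complex_cnj_cnj complex_cnj_mult)

lemma cinner_diff_left: "cinner (x - y) z = cinner x z - cinner y z"
  by (metis cinner_add_left diff_add_cancel eq_diff_eq)

lemma scaleC_diff_right: "scaleC c (x - y) = scaleC c x - scaleC c y"
  by (metis diff_add_cancel eq_diff_eq scaleC_add_right)

text \<open>
  The imaginary part of \<open>cinner u v\<close> is the real inner product of \<open>-\<i>u\<close> and \<open>v\<close>, and the domain of a
  complex linear operator contains \<open>-\<i>x\<close> along with \<open>x\<close>.
\<close>

lemma cinner_eq_if_inner_eq:
  assumes "clinear_on D T" and "\<And>x. x \<in> D \<Longrightarrow> inner (T x) y = inner x z" and "x \<in> D"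
  shows "cinner (T x) y = cinner x z"
proof (rule complex_eqI)
  show "Re (cinner (T x) y) = Re (cinner x z)"
    using assms(2,3) by (simp flip: inner_eq_Re_cinner)
  have Im: "Im (cinner u v) = inner (scaleC (- \<i>) u) v" for u v :: "'c::complex_inner"
    by (simp add: inner_eq_Re_cinner cinner_scaleC_left)
  show "Im (cinner (T x) y) = Im (cinner x z)"
    using assms unfolding Im clinear_on_def csubspace_def by metis
qed

lemma clinear_on_ident: "csubspace S \<Longrightarrow> clinear_on S (\<lambda>x. x)"
  by (simp add: clinear_on_def)

lemma clinear_on_imp_scaleR:
  "clinear_on D T \<Longrightarrow> x \<in> D \<Longrightarrow> T (r *\<^sub>R x) = r *\<^sub>R T x"
  by (simp add: clinear_on_def scaleR_eq_scaleC)

lemma clinear_on_diff: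
  assumes "clinear_on D T" "x \<in> D" "y \<in> D"
  shows "T (x - y) = T x - T y"
proof -
  have "csubspace D" using assms(1) by (simp add: clinear_on_def)
  then have "T ((x - y) + y) = T (x - y) + T y"
    using assms csubspace_diff[of D x y] unfolding clinear_on_def by blast
  then show ?thesis by simp
qed

lemma clinear_on_imp_csubspace_image:
  assumes "clinear_on D T"
  shows "csubspace (T ` D)"
proof -
  have "0 = T 0" using clinear_on_imp_scaleR[OF assms, of 0 0] assms
    by (simp add: clinear_on_def csubspace_def)
  then show ?thesis
    using assms unfolding clinear_on_def csubspace_def by (auto simp: image_iff) metis+
qed

lemma dense_cinner_cancel:
  assumes "closure D = UNIV" and eq: "\<And>x. x \<in> D \<Longrightarrow> cinner x y = cinner x z"
  shows "y = z"
proof -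
  have "closure D \<subseteq> {x. inner (y - z) x = 0}"
    by (rule closure_minimal[OF _ closed_hyperplane])
      (use eq in \<open>auto simp: inner_commute[of "y - z"] inner_diff_right inner_eq_Re_cinner[of _ y]
        inner_eq_Re_cinner[of _ z]\<close>)
  then have "inner (y - z) (y - z) = 0" using assms(1) by blast
  then show ?thesis by simp
qed

section \<open>Ranges of adjoints\<close>

lemma orthogonal_comp_iff: "y \<in> S\<^sup>\<bottom> \<longleftrightarrow> (\<forall>x\<in>S. inner x y = 0)"
  by (simp add: orthogonal_comp_def orthogonal_def)

text \<open>
  \<open>orthogonal_comp\<close> refers to the real inner product; for a complex subspace it agrees with the
  complex orthogonal complement, which is what makes it closed under complex scaling.
\<close>

lemma csubspace_orthogonal_comp:
  assumes "csubspace S"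
  shows "csubspace (S\<^sup>\<bottom>)"
proof -
  have "scaleC c y \<in> S\<^sup>\<bottom>" if "y \<in> S\<^sup>\<bottom>" for c y
  proof -
    have "cinner x y = cinner x 0" if "x \<in> S" for x
      using cinner_eq_if_inner_eq[OF clinear_on_ident[OF assms], of y 0] \<open>y \<in> S\<^sup>\<bottom>\<close> that
      by (simp add: orthogonal_comp_iff)
    moreover have "cinner x 0 = 0" for x :: 'a
      using cinner_scaleC_right[of x 0 0] scaleR_eq_scaleC[of 0 "0 :: 'a"] by simp
    ultimately show ?thesis
      by (simp add: orthogonal_comp_iff inner_eq_Re_cinner cinner_scaleC_right)
  qed
  then show ?thesis
    using subspace_orthogonal_comp[of S] by (simp add: csubspace_def subspace_def)
qed

lemma closed_orthogonal_comp: "closed (S\<^sup>\<bottom>)"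
proof -
  have "S\<^sup>\<bottom> = (\<Inter>x\<in>S. {y. inner x y = 0})" by (auto simp: orthogonal_comp_iff)
  then show ?thesis by (simp add: closed_INT closed_hyperplane)
qed

text \<open>
  The closed range theorem. The inclusion from left to right only uses \<open>\<langle>A x, w\<rangle> = \<langle>x, A\<^sup>* w\<rangle>\<close>. For the
  converse, let \<open>y\<close> be orthogonal to the kernel. Then \<open>\<langle>x, y\<rangle>\<close> depends on \<open>A x\<close> alone, and choosing
  preimages of controlled norm shows that it depends boundedly on \<open>A x\<close>; a Riesz vector \<open>w\<close> of this
  functional on the range has \<open>A\<^sup>* w = y\<close>.
\<close>

lemma ran_adj_eq_orthogonal_comp_kernel:
  fixes A :: "'b::chilbert_space \<Rightarrow> 'c::chilbert_space"
  assumes A: "densely_defined_closed D A" and range: "closed (A ` D)"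
  shows "ran_adj D A = {x \<in> D. A x = 0}\<^sup>\<bottom>"
proof -
  have lin: "clinear_on D A" and dense: "closure D = UNIV"
    and graph: "closed {(x, A x) | x. x \<in> D}"
    using A by (simp_all add: densely_defined_closed_def)
  have csub: "csubspace D" using lin by (simp add: clinear_on_def)
  then have sub: "subspace D" by (rule csubspace_imp_subspace)
  have add: "A (x + y) = A x + A y" if "x \<in> D" "y \<in> D" for x y
    using lin that by (simp add: clinear_on_def)
  have adj: "w \<in> adj_dom UNIV UNIV D A \<and> adj UNIV UNIV D A w = z"
    if "\<And>x. x \<in> D \<Longrightarrow> cinner (A x) w = cinner x z" for w z
  proof -
    have "w \<in> adj_dom UNIV UNIV D A" using that by (auto simp: adj_dom_def)
    moreover have "(THE z. z \<in> UNIV \<and> (\<forall>x\<in>D. cinner (A x) w = cinner x z)) = z"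
    proof (rule the_equality)
      fix z' assume "z' \<in> UNIV \<and> (\<forall>x\<in>D. cinner (A x) w = cinner x z')"
      then show "z' = z" using that by (intro dense_cinner_cancel[OF dense]) simp
    qed (use that in simp)
    ultimately show ?thesis by (simp add: adj_def)
  qed
  show ?thesis
  proof
    show "ran_adj D A \<subseteq> {x \<in> D. A x = 0}\<^sup>\<bottom>"
    proof
      fix y assume "y \<in> ran_adj D A"
      then obtain w where w: "w \<in> adj_dom UNIV UNIV D A" "y = adj UNIV UNIV D A w"
        by (auto simp: ran_adj_def)
      then obtain z where z: "\<And>x. x \<in> D \<Longrightarrow> cinner (A x) w = cinner x z"
        by (auto simp: adj_dom_def)
      have "y = z" using adj[OF z] w by simp
      then show "y \<in> {x \<in> D. A x = 0}\<^sup>\<bottom>"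
        using z by (auto simp: orthogonal_comp_iff inner_eq_Re_cinner)
          (metis inner_eq_Re_cinner inner_zero_left)
    qed
    show "{x \<in> D. A x = 0}\<^sup>\<bottom> \<subseteq> ran_adj D A"
    proof
      fix y assume y: "y \<in> {x \<in> D. A x = 0}\<^sup>\<bottom>"
      obtain C where C: "\<And>z. z \<in> A ` D \<Longrightarrow> \<exists>x\<in>D. A x = z \<and> norm x \<le> C * norm z"
        using closed_range_operator_bounded_preimages[OF sub add clinear_on_imp_scaleR[OF lin] graph range]
        by blast
      obtain g where g: "\<And>z. z \<in> A ` D \<Longrightarrow> g z \<in> D \<and> A (g z) = z \<and> norm (g z) \<le> C * norm z"
        using C by metis
      \<comment> \<open>Preimages of the same point differ by an element of the kernel, to which \<open>y\<close> is orthogonal.\<close>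
      have gA: "inner (g (A x)) y = inner x y" if "x \<in> D" for x
      proof -
        have "x - g (A x) \<in> {x \<in> D. A x = 0}"
          using that g[of "A x"] csub by (simp add: csubspace_diff clinear_on_diff[OF lin])
        then show ?thesis using y by (auto simp: orthogonal_comp_iff inner_diff_left)
      qed
      obtain w where w: "\<And>z. z \<in> A ` D \<Longrightarrow> inner (g z) y = inner z w"
      proof (rule riesz_representation_on_complete_subspace[of "A ` D" "\<lambda>z. inner (g z) y" "\<bar>C\<bar> * norm y"])
        show "subspace (A ` D)"
          by (intro csubspace_imp_subspace clinear_on_imp_csubspace_image lin)
        show "complete (A ` D)" using range by (simp add: complete_eq_closed)
        show "inner (g (u + v)) y = inner (g u) y + inner (g v) y" if "u \<in> A ` D" "v \<in> A ` D" for u v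
          using that sub by (auto simp: gA subspace_add inner_add_left simp flip: add)
        show "inner (g (r *\<^sub>R u)) y = r * inner (g u) y" if "u \<in> A ` D" for r u
          using that sub by (auto simp: gA subspace_scale simp flip: clinear_on_imp_scaleR[OF lin])
        show "\<bar>inner (g u) y\<bar> \<le> \<bar>C\<bar> * norm y * norm u" if "u \<in> A ` D" for u
        proof -
          have "\<bar>inner (g u) y\<bar> \<le> norm (g u) * norm y" by (rule Cauchy_Schwarz_ineq2)
          also have "norm (g u) \<le> \<bar>C\<bar> * norm u"
            using g[OF that] by (smt (verit) abs_ge_self mult_right_mono norm_ge_zero)
          finally show ?thesis by (simp add: mult_right_mono mult.commute mult.left_commute)
        qed
      qed blast
      then have "inner (A x) w = inner x y" if "x \<in> D" for x
        using gA that by (metis imageI)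
      then have "cinner (A x) w = cinner x y" if "x \<in> D" for x
        using cinner_eq_if_inner_eq[OF lin] that by blast
      then show "y \<in> ran_adj D A"
        using adj by (force simp: ran_adj_def)
    qed
  qed
qed

section \<open>Orthogonal projections and blocks\<close>

text \<open>
  The adjoint of the canonical embedding of a closed subspace is the orthogonal projection onto it.
\<close>

abbreviation oproj :: "'b::chilbert_space set \<Rightarrow> 'b \<Rightarrow> 'b"
  where "oproj V \<equiv> adj V UNIV V (emb V)"

lemma oproj_unique:
  assumes V: "csubspace V" and z: "z \<in> V" "\<And>x. x \<in> V \<Longrightarrow> inner x y = inner x z"
  shows "oproj V y = z"
proof -
  have c: "cinner (emb V x) y = cinner x z" if "x \<in> V" for x
    using cinner_eq_if_inner_eq[OF clinear_on_ident[OF V], of y z x] z(2) that by (simp add: emb_def)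
  have "(THE z. z \<in> V \<and> (\<forall>x\<in>V. cinner (emb V x) y = cinner x z)) = z"
  proof (rule the_equality)
    fix z' assume z': "z' \<in> V \<and> (\<forall>x\<in>V. cinner (emb V x) y = cinner x z')"
    then have "inner (z' - z) z' = inner (z' - z) z"
      using c V z(1) by (simp add: inner_eq_Re_cinner csubspace_diff)
    then have "inner (z' - z) (z' - z) = 0" by (simp add: inner_diff_right)
    then show "z' = z" by simp
  qed (use c z(1) in simp)
  moreover have "y \<in> adj_dom V UNIV V (emb V)" using c z(1) by (auto simp: adj_dom_def)
  ultimately show ?thesis by (simp add: adj_def)
qed

lemma oproj:
  assumes V: "csubspace V" "closed V"
  shows oproj_in: "oproj V y \<in> V"
    and inner_oproj: "x \<in> V \<Longrightarrow> inner x (oproj V y) = inner x y"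
proof -
  obtain z where z: "z \<in> V" "\<And>x. x \<in> V \<Longrightarrow> inner x y = inner x z"
  proof (rule riesz_representation_on_complete_subspace[of V "\<lambda>x. inner x y" "norm y"])
    show "\<bar>inner x y\<bar> \<le> norm y * norm x" for x
      using Cauchy_Schwarz_ineq2[of x y] by (simp add: mult.commute)
  qed (use V in \<open>auto simp: csubspace_imp_subspace complete_eq_closed inner_add_left\<close>)
  then have "oproj V y = z" using V(1) by (intro oproj_unique)
  then show "oproj V y \<in> V" and "x \<in> V \<Longrightarrow> inner x (oproj V y) = inner x y"
    using z by auto
qed

lemma diff_oproj_in_orthogonal_comp:
  "csubspace V \<Longrightarrow> closed V \<Longrightarrow> y - oproj V y \<in> V\<^sup>\<bottom>"
  by (simp add: orthogonal_comp_iff inner_diff_right inner_oproj)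

lemma oproj_in_bounded_ops:
  assumes V: "csubspace V" "closed V"
  shows "oproj V \<in> bounded_ops UNIV V"
proof -
  have "oproj V (x + y) = oproj V x + oproj V y" for x y
    using V by (intro oproj_unique)
      (simp_all add: oproj_in inner_oproj inner_add_right csubspace_imp_subspace subspace_add)
  moreover have "oproj V (scaleC c x) = scaleC c (oproj V x)" for c x
  proof (rule oproj_unique[OF V(1)])
    show "scaleC c (oproj V x) \<in> V" using V(1) oproj_in[OF V, of x] by (simp add: csubspace_def)
    show "inner u (scaleC c x) = inner u (scaleC c (oproj V x))" if "u \<in> V" for u
      using cinner_eq_if_inner_eq[OF clinear_on_ident[OF V(1)] inner_oproj[OF V, symmetric] that, of x]
      by (simp add: inner_eq_Re_cinner cinner_scaleC_right)
  qed
  moreover have "norm (oproj V x) \<le> 1 * norm x" for x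
  proof (cases "oproj V x = 0")
    case False
    have "norm (oproj V x) * norm (oproj V x) = inner (oproj V x) x"
      using inner_oproj[OF V oproj_in[OF V], of x x]
      by (simp add: power2_norm_eq_inner flip: power2_eq_square)
    also have "\<dots> \<le> norm (oproj V x) * norm x" by (rule norm_cauchy_schwarz)
    finally show ?thesis using False by simp
  qed simp
  ultimately show ?thesis
    using oproj_in[OF V] by (intro bounded_opsI[of _ _ _ 1]) (auto simp: clinear_on_def csubspace_def)
qed

lemma compose_in_bounded_ops:
  assumes S: "S \<in> bounded_ops U V" and T: "T \<in> bounded_ops V W"
  shows "compose U T S \<in> bounded_ops U W"
proof -
  obtain K L where K: "\<And>x. x \<in> U \<Longrightarrow> norm (S x) \<le> K * norm x"
    and L: "\<And>x. x \<in> V \<Longrightarrow> norm (T x) \<le> L * norm x"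
    by (metis S T bounded_ops_normE)
  have SV: "S x \<in> V" if "x \<in> U" for x using S that by (auto simp: bounded_ops_def)
  have "norm (T (S x)) \<le> \<bar>L\<bar> * K * norm x" if x: "x \<in> U" for x
  proof -
    have "norm (T (S x)) \<le> \<bar>L\<bar> * norm (S x)"
      using L[OF SV[OF x]] by (smt (verit) mult_right_mono norm_ge_zero)
    also have "\<dots> \<le> \<bar>L\<bar> * (K * norm x)" using K[OF x] by (simp add: mult_left_mono)
    finally show ?thesis by (simp add: mult.assoc)
  qed
  moreover have "clinear_on U (compose U T S)"
    using S T SV by (auto simp: bounded_ops_def clinear_on_def csubspace_def compose_eq)
  moreover have "T (S x) \<in> W" if "x \<in> U" for x
    using T SV[OF that] by (auto simp: bounded_ops_def)
  ultimately show ?thesis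
    by (intro bounded_opsI[of _ _ _ "\<bar>L\<bar> * K"]) (auto simp: compose_eq)
qed

lemma diff_in_bounded_ops:
  assumes S: "S \<in> bounded_ops U V" and T: "T \<in> bounded_ops U V" and V: "csubspace V"
  shows "(\<lambda>x\<in>U. S x - T x) \<in> bounded_ops U V"
proof -
  obtain K L where K: "\<And>x. x \<in> U \<Longrightarrow> norm (S x) \<le> K * norm x"
    and L: "\<And>x. x \<in> U \<Longrightarrow> norm (T x) \<le> L * norm x"
    by (metis S T bounded_ops_normE)
  have "norm (S x - T x) \<le> (K + L) * norm x" if "x \<in> U" for x
    using norm_triangle_ineq4[of "S x" "T x"] K[OF that] L[OF that] by (simp add: distrib_right)
  moreover have "clinear_on U (\<lambda>x\<in>U. S x - T x)"
    using S T by (auto simp: bounded_ops_def clinear_on_def csubspace_def scaleC_diff_right)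
  moreover have "S x - T x \<in> V" if "x \<in> U" for x
    using S T V that by (auto simp: bounded_ops_def intro!: csubspace_diff)
  ultimately show ?thesis by (intro bounded_opsI[of _ _ _ "K + L"]) auto
qed

lemma block_eq:
  assumes "u \<in> U"
  shows "block V U a u = oproj V (a u)"
  using assms by (simp add: block_def compose_eq emb_def)

lemma block_in_bounded_ops:
  assumes a: "a \<in> bounded_ops UNIV UNIV" and "csubspace U" "csubspace V" "closed V"
  shows "block V U a \<in> bounded_ops U V"
proof -
  have "emb U \<in> bounded_ops U UNIV"
    using \<open>csubspace U\<close> by (auto simp: bounded_ops_def emb_def clinear_on_def csubspace_def
        intro!: exI[of _ 1])
  then show ?thesis
    unfolding block_def using a assms(3,4)
    by (blast intro: compose_in_bounded_ops oproj_in_bounded_ops)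
qed

text \<open>
  By the Lax--Milgram lemma, strict positivity makes \<open>T\<close> bijective. Surjectivity matters because
  \<open>op_inv\<close> is built from \<open>inv_into\<close>, whose values outside the range of \<open>T\<close> are unspecified.
\<close>

lemma op_inv_in_bounded_ops:
  fixes V :: "'a::chilbert_space set"
  assumes T: "T \<in> bounded_ops V V" and "closed V" and "\<alpha> > 0" and Re: "Re_ge V T \<alpha>"
  shows "bij_betw T V V" and "op_inv V V T \<in> bounded_ops V V"
proof -
  have lin: "clinear_on V T" and ext: "T ` V \<subseteq> V" using T by (auto simp: bounded_ops_def)
  obtain K where K: "\<And>x. x \<in> V \<Longrightarrow> norm (T x) \<le> K * norm x"
    using T by (auto simp: bounded_ops_def)
  have V: "csubspace V" using lin by (simp add: clinear_on_def)
  have coercive: "\<alpha> * (norm x)\<^sup>2 \<le> inner (T x) x" if "x \<in> V" for x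
    using Re that by (simp add: Re_ge_def inner_eq_Re_cinner)
  have add: "T (x + y) = T x + T y" if "x \<in> V" "y \<in> V" for x y
    using lin that by (simp add: clinear_on_def)
  note lm = lax_milgram_on_complete_subspace[of V T K \<alpha>,
      OF csubspace_imp_subspace[OF V] _ _ add clinear_on_imp_scaleR[OF lin] K \<open>\<alpha> > 0\<close> coercive]
  show bij: "bij_betw T V V" using lm(1) ext \<open>closed V\<close> by (auto simp: complete_eq_closed)
  have below: "norm x \<le> norm (T x) / \<alpha>" if "x \<in> V" for x
    using lm(2) that ext \<open>closed V\<close> by (auto simp: complete_eq_closed)
  let ?S = "inv_into V T"
  have S: "?S y \<in> V" "T (?S y) = y" if "y \<in> V" for y
    using bij that by (auto simp: bij_betw_def inv_into_into f_inv_into_f)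
  have S_eq: "?S y = x" if "x \<in> V" "T x = y" for x y
    using bij that by (auto simp: bij_betw_def)
  have "?S (x + y) = ?S x + ?S y" if "x \<in> V" "y \<in> V" for x y
    using S[OF that(1)] S[OF that(2)] V by (intro S_eq) (auto simp: add csubspace_def)
  moreover have "?S (scaleC c x) = scaleC c (?S x)" if "x \<in> V" for c x
    using S[OF that] V lin by (intro S_eq) (auto simp: clinear_on_def csubspace_def)
  ultimately have "clinear_on V (op_inv V V T)"
    using V by (auto simp: clinear_on_def op_inv_def csubspace_def)
  moreover have "norm (op_inv V V T y) \<le> 1 / \<alpha> * norm y" if "y \<in> V" for y
    using below[OF S(1)[OF that]] S(2)[OF that] that by (simp add: op_inv_def)
  moreover have "op_inv V V T y \<in> V" if "y \<in> V" for y using S(1) that by (simp add: op_inv_def)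
  moreover have "op_inv V V T \<in> extensional V" by (simp add: op_inv_def)
  ultimately show "op_inv V V T \<in> bounded_ops V V" by (intro bounded_opsI)
qed

section \<open>Hausdorff initial topologies\<close>

lemma Hausdorff_space_initial_topology:
  assumes Hausdorff: "\<And>p. p \<in> F \<Longrightarrow> Hausdorff_space (snd p)"
    and maps: "\<And>p x. p \<in> F \<Longrightarrow> x \<in> X \<Longrightarrow> fst p x \<in> topspace (snd p)"
    and separating: "\<And>x y. x \<in> X \<Longrightarrow> y \<in> X \<Longrightarrow> (\<And>p. p \<in> F \<Longrightarrow> fst p x = fst p y) \<Longrightarrow> x = y"
  shows "Hausdorff_space (initial_topology X F)"
  unfolding Hausdorff_space_def topspace_initial_topology
proof (intro allI impI, elim conjE)
  fix x y assume xy: "x \<in> X" "y \<in> X" "x \<noteq> y"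
  then obtain p where "p \<in> F" "fst p x \<noteq> fst p y" using separating by blast
  then obtain f Y where f: "(f, Y) \<in> F" "f x \<noteq> f y" by (cases p) simp
  moreover have "Hausdorff_space Y" "f x \<in> topspace Y" "f y \<in> topspace Y"
    using Hausdorff[OF f(1)] maps[OF f(1)] xy by simp_all
  ultimately obtain U V where UV: "openin Y U" "openin Y V" "f x \<in> U" "f y \<in> V" "disjnt U V"
    using f(2) unfolding Hausdorff_space_def by blast
  have "openin (initial_topology X F) (f -` W \<inter> X)" if "openin Y W" for W
    unfolding initial_topology_def using f(1) that by (intro topology_generated_by_Basis) blast
  then show "\<exists>U V. openin (initial_topology X F) U \<and> openin (initial_topology X F) V \<and>
      x \<in> U \<and> y \<in> V \<and> disjnt U V"
    using UV xy by (intro exI[of _ "f -` U \<inter> X"] exI[of _ "f -` V \<inter> X"]) (auto simp: disjnt_def)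
qed

lemma topspace_weak_op_topology [simp]: "topspace (weak_op_topology U V) = bounded_ops U V"
  by (simp add: weak_op_topology_def)

lemma Hausdorff_space_weak_op_topology:
  assumes V: "csubspace V"
  shows "Hausdorff_space (weak_op_topology U V)"
  unfolding weak_op_topology_def
proof (rule Hausdorff_space_initial_topology)
  fix S T assume S: "S \<in> bounded_ops U V" and T: "T \<in> bounded_ops U V"
    and eq: "\<And>p. p \<in> {(\<lambda>T. cinner (T u) v, euclidean :: complex topology) | u v. u \<in> U \<and> v \<in> V}
      \<Longrightarrow> fst p S = fst p T"
  have weak: "cinner (S u) v = cinner (T u) v" if "u \<in> U" "v \<in> V" for u v
    using eq[of "(\<lambda>T. cinner (T u) v, euclidean)"] that by auto
  show "S = T"
  proof (rule extensionalityI[of _ U])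
    show "S \<in> extensional U" "T \<in> extensional U" using S T by (simp_all add: bounded_ops_def)
    fix u assume u: "u \<in> U"
    then have "S u - T u \<in> V" using S T V by (auto simp: bounded_ops_def intro!: csubspace_diff)
    then have "inner (S u - T u) (S u - T u) = 0"
      using weak[OF u] by (simp add: inner_eq_Re_cinner cinner_diff_left)
    then show "S u = T u" by simp
  qed
qed auto

section \<open>Recovering the operator\<close>

text \<open>
  Block elimination for plain functions. Equal inverses force \<open>a\<^sub>0\<^sub>0 = b\<^sub>0\<^sub>0\<close>. The inverse is then a common
  bijection of \<open>R\<^sub>0\<close>, which cancels on the right in the second datum and on the left in the third, and
  the correction term of the Schur complement is the same for both.
\<close>

lemma Schur_data_determine_blocks:
  fixes R0 :: "'a set" and R1 :: "'b set" and a11 b11 :: "'b \<Rightarrow> 'c::group_add"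
  assumes a00: "bij_betw a00 R0 R0" and b00: "bij_betw b00 R0 R0"
    and a01: "a01 ` R1 \<subseteq> R0" and b01: "b01 ` R1 \<subseteq> R0"
    and inv: "op_inv R0 R0 a00 = op_inv R0 R0 b00"
    and left: "\<And>y. y \<in> R0 \<Longrightarrow> a10 (op_inv R0 R0 a00 y) = b10 (op_inv R0 R0 b00 y)"
    and right: "\<And>x. x \<in> R1 \<Longrightarrow> op_inv R0 R0 a00 (a01 x) = op_inv R0 R0 b00 (b01 x)"
    and Schur: "\<And>x. x \<in> R1 \<Longrightarrow>
      a11 x - a10 (op_inv R0 R0 a00 (a01 x)) = b11 x - b10 (op_inv R0 R0 b00 (b01 x))"
  shows "x \<in> R0 \<Longrightarrow> a00 x = b00 x" and "x \<in> R0 \<Longrightarrow> a10 x = b10 x"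
    and "y \<in> R1 \<Longrightarrow> a01 y = b01 y" and "y \<in> R1 \<Longrightarrow> a11 y = b11 y"
proof -
  have inv_left: "op_inv R0 R0 T (T x) = x" if "bij_betw T R0 R0" "x \<in> R0" for T x
    using that by (auto simp: op_inv_def bij_betw_def)
  have inv_right: "op_inv R0 R0 T y \<in> R0" "T (op_inv R0 R0 T y) = y"
    if "bij_betw T R0 R0" "y \<in> R0" for T y
    using that by (auto simp: op_inv_def bij_betw_def inv_into_into f_inv_into_f)
  have a00_in: "a00 x \<in> R0" if "x \<in> R0" for x using a00 that by (auto simp: bij_betw_def)
  show eq00: "a00 x = b00 x" if "x \<in> R0" for x
    using inv_right(2)[OF b00 a00_in[OF that]] inv_left[OF a00 that] inv by simp
  show eq10: "a10 x = b10 x" if "x \<in> R0" for x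
    using left[OF a00_in[OF that]] inv_left[OF a00 that] inv by simp
  show eq01: "a01 x = b01 x" if "x \<in> R1" for x
    using right[OF that] inv_right(2)[OF a00, of "a01 x"] inv_right(2)[OF a00, of "b01 x"] that a01 b01 inv
    by (metis image_subset_iff)
  show "a11 x = b11 x" if "x \<in> R1" for x
  proof -
    have "op_inv R0 R0 a00 (a01 x) \<in> R0" using inv_right(1)[OF a00] a01 that by blast
    then have "a11 x - b10 (op_inv R0 R0 a00 (a01 x)) = b11 x - b10 (op_inv R0 R0 a00 (a01 x))"
      using Schur[OF that] eq10 by (simp only: right[OF that, symmetric])
    from arg_cong[OF this, of "\<lambda>u. u + b10 (op_inv R0 R0 a00 (a01 x))"]
    show ?thesis by simp
  qed
qed

text \<open>
  If \<open>U\<close> is one of the two summands and \<open>x \<in> U\<close>, both projections of \<open>a x - b x\<close> vanish, so it is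
  orthogonal to \<open>V\<close> and to \<open>V\<^sup>\<bottom>\<close>, hence 0. Since \<open>V\<close> and \<open>V\<^sup>\<bottom>\<close> together span the space, additivity
  finishes the argument.
\<close>

lemma blocks_determine_operator:
  fixes a b :: "'b::chilbert_space \<Rightarrow> 'b"
  assumes a: "a \<in> bounded_ops UNIV UNIV" and b: "b \<in> bounded_ops UNIV UNIV"
    and V: "csubspace V" "closed V"
    and blocks: "\<And>U W x. U \<in> {V, V\<^sup>\<bottom>} \<Longrightarrow> W \<in> {V, V\<^sup>\<bottom>} \<Longrightarrow> x \<in> U \<Longrightarrow> block W U a x = block W U b x"
  shows "a = b"
proof
  have comp: "csubspace (V\<^sup>\<bottom>)" "closed (V\<^sup>\<bottom>)"
    using V(1) by (simp_all add: csubspace_orthogonal_comp closed_orthogonal_comp)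
  have on: "a x = b x" if U: "U \<in> {V, V\<^sup>\<bottom>}" and x: "x \<in> U" for U x
  proof -
    have proj: "oproj W (a x) = oproj W (b x)" if "W \<in> {V, V\<^sup>\<bottom>}" for W
      using blocks[OF U that x] x by (simp add: block_eq)
    have "oproj W (a x - b x) = 0" if "W \<in> {V, V\<^sup>\<bottom>}" for W
    proof -
      have "clinear_on UNIV (oproj W)"
        using oproj_in_bounded_ops[of W] that V comp by (auto simp: bounded_ops_def)
      then show ?thesis using proj[OF that] by (simp add: clinear_on_diff)
    qed
    then have 0: "oproj V (a x - b x) = 0" "oproj (V\<^sup>\<bottom>) (a x - b x) = 0" by auto
    have "a x - b x \<in> V\<^sup>\<bottom>" using diff_oproj_in_orthogonal_comp[OF V, of "a x - b x"] 0 by simp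
    then have "oproj (V\<^sup>\<bottom>) (a x - b x) = a x - b x" by (intro oproj_unique comp) auto
    then show ?thesis using 0 by simp
  qed
  fix x
  have add: "T (y + z) = T y + T z" if "T \<in> bounded_ops UNIV UNIV" for T :: "'b \<Rightarrow> 'b" and y z
    using that by (simp add: bounded_ops_def clinear_on_def)
  have "x = oproj V x + (x - oproj V x)" by simp
  moreover have "a (oproj V x) = b (oproj V x)" using on oproj_in[OF V] by blast
  moreover have "a (x - oproj V x) = b (x - oproj V x)"
    using on diff_oproj_in_orthogonal_comp[OF V] by blast
  ultimately show "a x = b x" using add[OF a] add[OF b] by metis
qed

theorem proposition5p4:
  fixes A0 :: "'a::chilbert_space \<Rightarrow> 'b::chilbert_space"
    and A1 :: "'b \<Rightarrow> 'c::chilbert_space"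
    and D0 :: "'a set" and D1 :: "'b set"
    and \<alpha> \<beta> :: real
  assumes "densely_defined_closed D0 A0"
    and "densely_defined_closed D1 A1"
    and "closed_exact D0 A0 D1 A1"
    and "\<alpha> > 0" and "\<beta> > 0"
  shows "Hausdorff_space (tau_H \<alpha> \<beta> D0 A0 D1 A1)"
proof -
  define R0 where "R0 = A0 ` D0"
  define R1 where "R1 = ran_adj D1 A1"
  define M where "M = coeffs \<alpha> \<beta> D0 A0 D1 A1"
  define inv00 where "inv00 a = op_inv R0 R0 (block R0 R0 a)" for a
  define schur where
    "schur a = (\<lambda>x\<in>R1. block R1 R1 a x - block R1 R0 a (inv00 a (block R0 R1 a x)))" for a

  have R0: "csubspace R0" "closed R0"
    using assms(1,3) unfolding R0_def densely_defined_closed_def closed_exact_def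
    by (blast intro: clinear_on_imp_csubspace_image)+
  have R1_eq: "R1 = R0\<^sup>\<bottom>"
    using assms(2,3) unfolding R0_def R1_def closed_exact_def
    by (simp add: ran_adj_eq_orthogonal_comp_kernel)
  then have R1: "csubspace R1" "closed R1"
    using R0(1) by (simp_all add: csubspace_orthogonal_comp closed_orthogonal_comp)

  have M: "a \<in> bounded_ops UNIV UNIV" "Re_ge R0 (block R0 R0 a) \<alpha>" if "a \<in> M" for a
    using that by (simp_all add: M_def coeffs_def Let_def R0_def)
  have block: "block V U a \<in> bounded_ops U V" if "a \<in> M" "U \<in> {R0, R1}" "V \<in> {R0, R1}" for a U V
    using that R0 R1 M by (auto intro: block_in_bounded_ops)
  have bij00: "bij_betw (block R0 R0 a) R0 R0" and inv00: "inv00 a \<in> bounded_ops R0 R0"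
    if "a \<in> M" for a
    unfolding inv00_def
    using op_inv_in_bounded_ops[OF _ R0(2) \<open>\<alpha> > 0\<close> M(2)[OF that]] block[OF that] by auto
  have left: "compose R0 (block R1 R0 a) (inv00 a) \<in> bounded_ops R0 R1"
    and right: "compose R1 (inv00 a) (block R0 R1 a) \<in> bounded_ops R1 R0" if "a \<in> M" for a
    using inv00[OF that] block[OF that] by (auto intro: compose_in_bounded_ops)
  have schur: "schur a \<in> bounded_ops R1 R1" if "a \<in> M" for a
  proof -
    \<comment> \<open>Written with \<open>compose\<close>, the Schur complement is visibly built from bounded operators.\<close>
    have "schur a = (\<lambda>x\<in>R1. block R1 R1 a x -
        compose R1 (block R1 R0 a) (compose R1 (inv00 a) (block R0 R1 a)) x)"
      by (auto simp: schur_def compose_eq)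
    moreover have "compose R1 (block R1 R0 a) (compose R1 (inv00 a) (block R0 R1 a)) \<in> bounded_ops R1 R1"
      by (rule compose_in_bounded_ops[OF right[OF that]]) (simp add: block[OF that])
    moreover have "block R1 R1 a \<in> bounded_ops R1 R1" by (simp add: block[OF that])
    ultimately show ?thesis using R1(1) by (simp add: diff_in_bounded_ops)
  qed

  have "Hausdorff_space (initial_topology M
    {(\<lambda>a. inv00 a, weak_op_topology R0 R0),
     (\<lambda>a. compose R0 (block R1 R0 a) (inv00 a), weak_op_topology R0 R1),
     (\<lambda>a. compose R1 (inv00 a) (block R0 R1 a), weak_op_topology R1 R0),
     (\<lambda>a. schur a, weak_op_topology R1 R1)})" (is "Hausdorff_space (initial_topology M ?F)")
  proof (rule Hausdorff_space_initial_topology)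
    show "Hausdorff_space (snd p)" if "p \<in> ?F" for p
      using that R0(1) R1(1) by (auto simp: Hausdorff_space_weak_op_topology)
    show "fst p a \<in> topspace (snd p)" if "p \<in> ?F" "a \<in> M" for p a
      using that(1) inv00[OF that(2)] left[OF that(2)] right[OF that(2)] schur[OF that(2)] by auto
    fix a b assume a: "a \<in> M" and b: "b \<in> M"
      and same: "\<And>p. p \<in> ?F \<Longrightarrow> fst p a = fst p b"
    have "\<forall>p\<in>?F. fst p a = fst p b" using same by blast
    then have eq_inv: "inv00 a = inv00 b"
      and eq_left: "compose R0 (block R1 R0 a) (inv00 a) = compose R0 (block R1 R0 b) (inv00 b)"
      and eq_right: "compose R1 (inv00 a) (block R0 R1 a) = compose R1 (inv00 b) (block R0 R1 b)"
      and eq_schur: "schur a = schur b"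
      \<comment> \<open>Simplification would use the first equation to rewrite the others.\<close>
      unfolding ball_simps fst_conv by blast+
    have into: "block R0 R1 a ` R1 \<subseteq> R0" "block R0 R1 b ` R1 \<subseteq> R0"
      using block[OF a, of R1 R0] block[OF b, of R1 R0] by (auto simp: bounded_ops_def)
    note eqs = Schur_data_determine_blocks[OF bij00[OF a] bij00[OF b] into, folded inv00_def,
        OF eq_inv, of "block R1 R0 a" "block R1 R0 b" "block R1 R1 a" "block R1 R1 b"]
    have "block V U a x = block V U b x"
      if "U \<in> {R0, R0\<^sup>\<bottom>}" "V \<in> {R0, R0\<^sup>\<bottom>}" "x \<in> U" for U V x
    proof -
      have 1: "block R1 R0 a (inv00 a y) = block R1 R0 b (inv00 b y)" if "y \<in> R0" for y
        using fun_cong[OF eq_left, of y] that by (simp add: compose_eq)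
      have 2: "inv00 a (block R0 R1 a y) = inv00 b (block R0 R1 b y)" if "y \<in> R1" for y
        using fun_cong[OF eq_right, of y] that by (simp add: compose_eq)
      have 3: "block R1 R1 a y - block R1 R0 a (inv00 a (block R0 R1 a y)) =
          block R1 R1 b y - block R1 R0 b (inv00 b (block R0 R1 b y))" if "y \<in> R1" for y
        using fun_cong[OF eq_schur, of y] that by (simp add: schur_def)
      show ?thesis
        using that unfolding R1_eq[symmetric]
        by (elim insertE emptyE) (simp_all add: eqs[OF 1 2 3])
    qed
    then show "a = b" by (rule blocks_determine_operator[OF M(1)[OF a] M(1)[OF b] R0])
  qed
  then show ?thesis
    by (simp only: tau_H_def Let_def M_def schur_def inv00_def R0_def R1_def)
qed

end
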